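(* Suppose that $R^TR$ is positive definite, that $\mathcal X\subset\mathbb R^d$ is a convex and compact set, and that $\epsilon_1=\epsilon_2=0$. Let $\{(\mathbf x^k,\mathbf y^k)\}$, with multipliers $\{\boldsymbol\lambda^k\}$, be a sequence generated by the ADMM algorithm described in the context, and suppose that the following hold. (i) The sequence $\{\boldsymbol\lambda^k\}$ is bounded and $\sum_{k=1}^\infty\|\boldsymbol\lambda^{k+1}-\boldsymbol\lambda^k\|^2<\infty$. (ii) For every $k$, $\mathbf x^{k+1}$ is a global minimizer of $L_\sigma(\cdot,\mathbf y^k;\boldsymbol\lambda^k)$ over $\mathcal X$, and $\mathbf y^{k+1}$ satisfies $$L_\sigma(\mathbf x^{k+1},\mathbf y^k;\boldsymbol\lambda^k)-L_\sigma(\mathbf x^{k+1},\mathbf y^{k+1};\boldsymbol\lambda^k)\ge 0\quad\text{and}\quad \mathbf 0\in\partial\Omega(\mathbf y^{k+1})+\sigma\Big(\mathbf y^{k+1}-R\mathbf x^{k+1}+\frac{\boldsymbol\lambda^k}{\sigma}\Big).$$ Then any accumulation point $(\mathbf x^*,\mathbf y^* )$ of the sequence $\{(\mathbf x^k,\mathbf y^k)\}$ satisfies $$\mathbf 0\in R^T\partial\Omega(\mathbf y^* )+N_{\mathcal X}(\mathbf x^* ),\qquad \mathbf y^*=R\mathbf x^*.$$ Hence $\mathbf x^*$ is a stationary point of the problem $\min_{\mathbf x\in\mathcal X}-\sum_{i=1}^Nc_iU((R\mathbf x)_{[i]})$ in the sense that $\mathbf 0\in R^T\partial\Omega(R\mathbf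 x^* )+N_{\mathcal X}(\mathbf x^* )$.
   Context: Utility. Fix $B\in\mathbb R$ and a function $U:\mathbb R\to\mathbb R$ such that: (1) $U$ is strictly increasing and continuous on $\mathbb R$; (2) $U$ is three times continuously differentiable on $(-\infty,B)$ and on $(B,\infty)$; (3) $U''>0$ on $(-\infty,B)$ and $U''<0$ on $(B,\infty)$; (4) $U'''>0$ on $(-\infty,B)$; (5) $U'(B^-)=\infty$ if and only if $U'(B^+)=\infty$, where $U'(B^\pm)=\lim_{y\to B^\pm}U'(y)$. Weights. For a vector $\mathbf y\in\mathbb R^N$, $y_{[i]}$ denotes its $i$-th smallest entry. For given probability weighting functions $\omega_-,\omega_+$ on $[0,1]$ put $a_i=\omega_-(i/N)-\omega_-((i-1)/N)$ and $b_i=\omega_+(1-(i-1)/N)-\omega_+(1-i/N)$; it is assumed that $a_i>0$ and $b_i>0$ for $i=1,\dots,N$. In an expression $c_iU(t)$ the weight $c_i=c_i(t)$ equals $a_i$ if $t\le B$ and $b_i$ if $t>B$. Define $\Omega(\mathbf y)=-\sum_{i=1}^Nc_iU(y_{[i]})$, where $c_i=c_i(y_{[i]})$. Problem and algorithm. $R\in\mathbb R^{N\times d}$, $\mathcal X\subset\mathbb R^d$, $\sigma>0$ is a constant, $I_{\mathcal X}$ is the indicator function of $\mathcal X$ ($0$ on $\mathcal X$, $+\infty$ elsewhere), and the augmented Lagrangian is $$L_\sigma(\mathbf x,\mathbf y;\boldsymbol\lambda)=\Omega(\mathbf y)+I_{\mathcal X}(\mathbf x)+\langle\boldsymbol\lambda,\mathbf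 y-R\mathbf x\rangle+\frac\sigma2\|\mathbf y-R\mathbf x\|_2^2 .$$ The ADMM algorithm starts from $\mathbf y^0,\boldsymbol\lambda^0\in\mathbb R^N$ and for $k=0,1,2,\dots$: computes $\mathbf x^{k+1}$ by minimizing $L_\sigma(\cdot,\mathbf y^k;\boldsymbol\lambda^k)$ over $\mathcal X$; computes $\mathbf y^{k+1}$ by solving $\min_{\mathbf y}L_\sigma(\mathbf x^{k+1},\mathbf y;\boldsymbol\lambda^k)$ exactly or approximately (in the sense of condition (ii) of the claim); and sets $\boldsymbol\lambda^{k+1}=\boldsymbol\lambda^k+\sigma(\mathbf y^{k+1}-R\mathbf x^{k+1})$. Its stopping test is $\|\mathbf y^k-R\mathbf x^k\|\le\epsilon_1$ and $\|\mathbf y^k-\mathbf y^{k-1}\|\le\epsilon_2$. Generalized gradients. $\partial\Omega(\mathbf y)$ is the Clarke generalized gradient, which at a point $\mathbf y$ near which $\Omega$ is locally Lipschitz is $\partial\Omega(\mathbf y)=\mathrm{conv}\{\lim_{i\to\infty}\nabla\Omega(\mathbf y^i):\mathbf y^i\to\mathbf y,\ \Omega\text{ differentiable at }\mathbf y^i\}$. For $\bar{\mathbf x}\in\mathcal X$, $N_{\mathcal X}(\bar{\mathbf x})=\{\mathbf z\in\mathbb R^d:\langle\mathbf z,\mathbf x-\bar{\mathbf x}\rangle\le0\ \forall\mathbf x\in\mathcal X\}$. *)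

theory Defs
  imports "HOL-Analysis.Analysis" "HOL-Library.Set_Algebras"
begin

definition C3_on :: "real set \<Rightarrow> (real \<Rightarrow> real) \<Rightarrow> bool" where
  "C3_on S f \<longleftrightarrow>
     (\<forall>k<3. (deriv ^^ k) f differentiable_on S) \<and> continuous_on S ((deriv ^^ 3) f)"

definition S_shaped_utility :: "real \<Rightarrow> (real \<Rightarrow> real) \<Rightarrow> bool" where
  "S_shaped_utility B U \<longleftrightarrow>
     strict_mono U \<and> continuous_on UNIV U \<and>
     C3_on {..<B} U \<and> C3_on {B<..} U \<and>
     (\<forall>t<B. (deriv ^^ 2) U t > 0) \<and> (\<forall>t>B. (deriv ^^ 2) U t < 0) \<and>
     (\<forall>t<B. (deriv ^^ 3) U t > 0) \<and>
     (filterlim (deriv U) at_top (at_left B) \<longleftrightarrow> filterlim (deriv U) at_top (at_right B))"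

definition prob_weighting :: "(real \<Rightarrow> real) \<Rightarrow> bool" where
  "prob_weighting w \<longleftrightarrow> mono_on {0..1} w \<and> w 0 = 0 \<and> w 1 = 1"

definition weight_loss :: "(real \<Rightarrow> real) \<Rightarrow> nat \<Rightarrow> nat \<Rightarrow> real" where
  "weight_loss w N i = w (real i / real N) - w ((real i - 1) / real N)"

definition weight_gain :: "(real \<Rightarrow> real) \<Rightarrow> nat \<Rightarrow> nat \<Rightarrow> real" where
  "weight_gain w N i = w (1 - (real i - 1) / real N) - w (1 - real i / real N)"

text \<open>The \<open>i\<close>-th smallest entry of \<open>y\<close>, counted with multiplicity, for \<open>1 \<le> i \<le> CARD('n)\<close>.\<close>

definition order_stat :: "real ^ 'n \<Rightarrow> nat \<Rightarrow> real" where
  "order_stat y i =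
     sorted_list_of_multiset (image_mset (\<lambda>j. y $ j) (mset_set (UNIV :: 'n::finite set))) ! (i - 1)"

definition Omega ::
  "real \<Rightarrow> (real \<Rightarrow> real) \<Rightarrow> (real \<Rightarrow> real) \<Rightarrow> (real \<Rightarrow> real) \<Rightarrow> real ^ 'n::finite \<Rightarrow> real" where
  "Omega B U wm wp y =
     - (\<Sum>i = 1..CARD('n).
          (if order_stat y i \<le> B then weight_loss wm CARD('n) i else weight_gain wp CARD('n) i)
            * U (order_stat y i))"

definition locally_lipschitz_at :: "('a::metric_space \<Rightarrow> 'b::metric_space) \<Rightarrow> 'a \<Rightarrow> bool" where
  "locally_lipschitz_at f x \<longleftrightarrow> (\<exists>e>0. \<exists>L. L-lipschitz_on (ball x e) f)"

definition limiting_gradients :: "('a::euclidean_space \<Rightarrow> real) \<Rightarrow> 'a \<Rightarrow> 'a set" where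
  "limiting_gradients f x =
     {g. \<exists>z G. z \<longlonglongrightarrow> x \<and> (\<forall>i. GDERIV f (z i) :> G i) \<and> G \<longlonglongrightarrow> g}"

definition clarke_dderiv :: "('a::euclidean_space \<Rightarrow> real) \<Rightarrow> 'a \<Rightarrow> 'a \<Rightarrow> ereal" where
  "clarke_dderiv f x v =
     Limsup (nhds x \<times>\<^sub>F at_right 0) (\<lambda>(z, t). ereal ((f (z + t *\<^sub>R v) - f z) / t))"

text \<open>
  At points near which \<open>f\<close> is locally Lipschitz, the gradient formula below agrees with
  \<open>{\<xi>. \<forall>v. \<xi> \<bullet> v \<le> clarke_dderiv f x v}\<close> (Clarke, Optimization and Nonsmooth Analysis, Theorem
  2.5.1).  At the remaining points (for \<open>Omega\<close>, possible when some entry equals \<open>B\<close>) the latter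
  set, with values of the directional derivative in the extended reals, is taken as the
  definition.  For continuous functions that are directionally Lipschitz, in particular
  for continuous functions that are monotone in every coordinate, it is the generalized gradient
  defined through the Clarke normal cone of the epigraph (loc. cit., Section 2.9).
  At an infinite slope of a continuous \<open>Omega\<close> it is empty.\<close>

definition clarke_gradient :: "('a::euclidean_space \<Rightarrow> real) \<Rightarrow> 'a \<Rightarrow> 'a set" where
  "clarke_gradient f x =
     (if locally_lipschitz_at f x then convex hull (limiting_gradients f x)
      else {\<xi>. \<forall>v. ereal (\<xi> \<bullet> v) \<le> clarke_dderiv f x v})"

text \<open>Empty outside \<open>X\<close>, so that membership in the cone includes feasibility.\<close>

definition normal_cone :: "'a::real_inner set \<Rightarrow> 'a \<Rightarrow> 'a set" where
  "normal_cone X xbar = (if xbar \<in> X then {z. \<forall>x\<in>X. z \<bullet> (x - xbar) \<le> 0} else {})"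

definition set_indicator :: "'a set \<Rightarrow> 'a \<Rightarrow> ereal" where
  "set_indicator X x = (if x \<in> X then 0 else \<infinity>)"

definition aug_lagrangian ::
  "(real ^ 'n \<Rightarrow> real) \<Rightarrow> (real ^ 'd) set \<Rightarrow> real ^ 'd ^ 'n \<Rightarrow> real
     \<Rightarrow> real ^ 'd \<Rightarrow> real ^ 'n \<Rightarrow> real ^ 'n \<Rightarrow> ereal" where
  "aug_lagrangian \<Omega> X R \<sigma> x y l =
     ereal (\<Omega> y) + set_indicator X x + ereal (l \<bullet> (y - R *v x))
       + ereal (\<sigma> / 2 * (norm (y - R *v x))\<^sup>2)"

definition positive_definite :: "real ^ 'd ^ 'd \<Rightarrow> bool" where
  "positive_definite A \<longleftrightarrow> transpose A = A \<and> (\<forall>v. v \<noteq> 0 \<longrightarrow> v \<bullet> (A *v v) > 0)"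

text \<open>
  An infinite run of the method, where the quality required of the approximate \<open>y\<close>-update is left
  to \<open>y_update_cond\<close>.  With both tolerances equal to zero the stopping test imposes no
  truncation, so it does not appear.  The value \<open>x 0\<close> is irrelevant.\<close>

definition admm_sequence ::
  "(real ^ 'n \<Rightarrow> real) \<Rightarrow> (real ^ 'd) set \<Rightarrow> real ^ 'd ^ 'n \<Rightarrow> real
     \<Rightarrow> (nat \<Rightarrow> real ^ 'd) \<Rightarrow> (nat \<Rightarrow> real ^ 'n) \<Rightarrow> (nat \<Rightarrow> real ^ 'n) \<Rightarrow> bool" where
  "admm_sequence \<Omega> X R \<sigma> x y l \<longleftrightarrow>
     (\<forall>k. x (Suc k) \<in> X \<and>
          (\<forall>x'\<in>X. aug_lagrangian \<Omega> X R \<sigma> (x (Suc k)) (y k) (l k)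
                    \<le> aug_lagrangian \<Omega> X R \<sigma> x' (y k) (l k)) \<and>
          l (Suc k) = l k + \<sigma> *\<^sub>R (y (Suc k) - R *v x (Suc k)))"

definition y_update_cond ::
  "(real ^ 'n \<Rightarrow> real) \<Rightarrow> (real ^ 'd) set \<Rightarrow> real ^ 'd ^ 'n \<Rightarrow> real
     \<Rightarrow> (nat \<Rightarrow> real ^ 'd) \<Rightarrow> (nat \<Rightarrow> real ^ 'n) \<Rightarrow> (nat \<Rightarrow> real ^ 'n) \<Rightarrow> bool" where
  "y_update_cond \<Omega> X R \<sigma> x y l \<longleftrightarrow>
     (\<forall>k. aug_lagrangian \<Omega> X R \<sigma> (x (Suc k)) (y k) (l k)
            - aug_lagrangian \<Omega> X R \<sigma> (x (Suc k)) (y (Suc k)) (l k) \<ge> 0 \<and>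
          0 \<in> clarke_gradient \<Omega> (y (Suc k))
                + {\<sigma> *\<^sub>R (y (Suc k) - R *v x (Suc k) + (1 / \<sigma>) *\<^sub>R l k)})"

definition accumulation_point :: "(nat \<Rightarrow> 'a::topological_space) \<Rightarrow> 'a \<Rightarrow> bool" where
  "accumulation_point s p \<longleftrightarrow> (\<exists>r. strict_mono r \<and> (s \<circ> r) \<longlonglongrightarrow> p)"

end

theory Submission
  imports Defs
begin

text \<open>
  Write \<open>r\<^sub>k = y\<^sub>k - R x\<^sub>k\<close>.  Substituting the multiplier update into the two optimality
  conditions gives, for every \<open>k\<close>,
  \<open>- l\<^sub>k\<^sub>+\<^sub>1 \<in> \<partial>\<Omega>(y\<^sub>k\<^sub>+\<^sub>1)\<close> and, up to the error \<open>\<sigma> R\<^sup>T(y\<^sub>k\<^sub>+\<^sub>1 - y\<^sub>k)\<close>, \<open>R\<^sup>T l\<^sub>k\<^sub>+\<^sub>1 \<in> N\<^sub>X(x\<^sub>k\<^sub>+\<^sub>1)\<close>.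
  If \<open>l\<^sub>k\<close> converges to \<open>l\<^sup>*\<close> along a further subsequence, the claim is that both inclusions survive
  in the limit: then \<open>R\<^sup>T(- l\<^sup>*)\<close> and \<open>R\<^sup>T l\<^sup>*\<close> are the two summands of \<open>0\<close>.  Two facts carry this.

  The errors vanish (\<open>admm_y_steps_tendsto_zero\<close>).  Since \<open>\<sigma> r\<^sub>k\<^sub>+\<^sub>1 = l\<^sub>k\<^sub>+\<^sub>1 - l\<^sub>k\<close>, the residuals tend to
  zero.  The \<open>x\<close>-step minimizes a convex quadratic, so it lowers the augmented Lagrangian by at
  least \<open>\<sigma>/2 \<parallel>R(x\<^sub>k\<^sub>+\<^sub>1 - x\<^sub>k)\<parallel>\<^sup>2\<close>; the \<open>y\<close>-step does not raise it; the multiplier step raises it by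
  \<open>\<parallel>l\<^sub>k\<^sub>+\<^sub>1 - l\<^sub>k\<parallel>\<^sup>2/\<sigma>\<close>, which is summable.  The values are bounded below because the iterates stay in a
  bounded set and \<open>Omega\<close> is bounded below there.  Hence the decreases are summable,
  \<open>R(x\<^sub>k\<^sub>+\<^sub>1 - x\<^sub>k)\<close> tends to zero, and so does \<open>y\<^sub>k\<^sub>+\<^sub>1 - y\<^sub>k\<close>.

  The Clarke gradient has a closed graph (\<open>clarke_gradient_closed_graph\<close>).  At a limit with an
  entry equal to \<open>B\<close> the function \<open>Omega\<close> may have an infinite slope, and it may even jump there
  because the weights change, so the usual result for Lipschitz functions does not suffice.  The
  closed graph holds for an arbitrary function: near a point of local Lipschitz continuity it follows
  from compactness of the set of limiting gradients, and elsewhere from the upper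
  semicontinuity of the extended directional derivative, which dominates the generalized
  gradient in both cases of its definition.
\<close>

section \<open>Difference quotients and limiting gradients\<close>

lemma GDERIV_imp_quotient_tendsto:
  fixes f :: "'a::euclidean_space \<Rightarrow> real"
  assumes "GDERIV f z :> G"
  shows "((\<lambda>t. (f (z + t *\<^sub>R v) - f z) / t) \<longlongrightarrow> G \<bullet> v) (at_right 0)"
proof -
  have "((\<lambda>t. z + t *\<^sub>R v) has_derivative (\<lambda>t. t *\<^sub>R v)) (at (0::real))"
    by (auto intro!: derivative_eq_intros)
  moreover have "(f has_derivative (\<lambda>h. h \<bullet> G)) (at (z + 0 *\<^sub>R v))"
    using assms by (simp add: gderiv_def)
  ultimately have "((\<lambda>t. f (z + t *\<^sub>R v)) has_derivative (\<lambda>t. (t *\<^sub>R v) \<bullet> G)) (at (0::real))"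
    by (rule has_derivative_compose)
  then have "((\<lambda>t. f (z + t *\<^sub>R v)) has_real_derivative G \<bullet> v) (at 0)"
    by (simp add: has_field_derivative_def inner_commute mult.commute[of _ "G \<bullet> v"])
  then show ?thesis
    by (auto simp: DERIV_def intro: tendsto_mono[OF at_le])
qed

text \<open>
  The difference quotient in direction \<open>G\<close> itself tends to \<open>\<parallel>G\<parallel>\<^sup>2\<close> and is at most \<open>L \<parallel>G\<parallel>\<close>.
\<close>

lemma norm_GDERIV_le_lipschitz:
  fixes f :: "'a::euclidean_space \<Rightarrow> real"
  assumes lip: "L-lipschitz_on S f" and "open S" "z \<in> S" and G: "GDERIV f z :> G"
  shows "norm G \<le> L"
proof -
  have "((\<lambda>t. z + t *\<^sub>R G) \<longlongrightarrow> z + 0 *\<^sub>R G) (at_right (0::real))"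
    by (intro tendsto_intros)
  then have ev: "\<forall>\<^sub>F t in at_right (0::real). z + t *\<^sub>R G \<in> S"
    using assms(2,3) by (auto dest: topological_tendstoD)
  have "\<forall>\<^sub>F t in at_right 0. (f (z + t *\<^sub>R G) - f z) / t \<le> L * norm G"
    using ev eventually_at_right_less
  proof eventually_elim
    case (elim t)
    have "f (z + t *\<^sub>R G) - f z \<le> L * dist (z + t *\<^sub>R G) z"
      using lipschitz_onD[OF lip elim(1) \<open>z \<in> S\<close>] by (simp add: dist_real_def)
    with elim(2) show ?case
      by (simp add: dist_norm pos_divide_le_eq mult_ac)
  qed
  then have "G \<bullet> G \<le> L * norm G"
    by (intro tendsto_upperbound[OF GDERIV_imp_quotient_tendsto[OF G]]) auto
  then have "norm G * norm G \<le> L * norm G"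
    by (simp add: dot_square_norm power2_eq_square)
  then show ?thesis
    using lipschitz_on_nonneg[OF lip] by (cases "G = 0") auto
qed

text \<open>
  Without sequences, closure properties need no diagonal argument: two approximations to
  within \<open>e/2\<close> compose.
\<close>

lemma limiting_gradients_iff:
  "g \<in> limiting_gradients f x \<longleftrightarrow>
     (\<forall>e>0. \<exists>z G. dist z x < e \<and> GDERIV f z :> G \<and> dist G g < e)"
proof
  assume "g \<in> limiting_gradients f x"
  then obtain z G where z: "z \<longlonglongrightarrow> x" "\<And>i. GDERIV f (z i) :> G i" and G: "G \<longlonglongrightarrow> g"
    by (auto simp: limiting_gradients_def)
  show "\<forall>e>0. \<exists>z G. dist z x < e \<and> GDERIV f z :> G \<and> dist G g < e"
  proof (intro allI impI)
    fix e :: real assume "e > 0"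
    then have "\<forall>\<^sub>F i in sequentially. dist (z i) x < e \<and> dist (G i) g < e"
      using z(1) G by (auto intro!: eventually_conj dest: tendstoD)
    then show "\<exists>z G. dist z x < e \<and> GDERIV f z :> G \<and> dist G g < e"
      using z(2) by (auto dest!: eventually_happens)
  qed
next
  assume near: "\<forall>e>0. \<exists>z G. dist z x < e \<and> GDERIV f z :> G \<and> dist G g < e"
  have "\<forall>n. \<exists>z G. dist z x < inverse (Suc n) \<and> GDERIV f z :> G \<and> dist G g < inverse (Suc n)"
    using near by simp
  then obtain z G where *: "\<And>n. dist (z n) x < inverse (Suc n)" "\<And>n. GDERIV f (z n) :> G n"
      "\<And>n. dist (G n) g < inverse (Suc n)"
    by metis
  have "(\<lambda>n. dist (z n) x) \<longlonglongrightarrow> 0"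
    by (rule tendsto_sandwich[OF _ _ tendsto_const LIMSEQ_inverse_real_of_nat])
       (use *(1) in \<open>auto intro!: always_eventually simp: less_imp_le\<close>)
  moreover have "(\<lambda>n. dist (G n) g) \<longlonglongrightarrow> 0"
    by (rule tendsto_sandwich[OF _ _ tendsto_const LIMSEQ_inverse_real_of_nat])
       (use *(3) in \<open>auto intro!: always_eventually simp: less_imp_le\<close>)
  ultimately show "g \<in> limiting_gradients f x"
    using *(2) by (auto simp: limiting_gradients_def tendsto_dist_iff[of _ x] tendsto_dist_iff[of _ g])
qed

lemma limiting_gradients_closed_graph:
  assumes "p \<longlonglongrightarrow> x" "g \<longlonglongrightarrow> \<xi>" "\<And>k. g k \<in> limiting_gradients f (p k)"
  shows "\<xi> \<in> limiting_gradients f x"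
  unfolding limiting_gradients_iff
proof (intro allI impI)
  fix e :: real assume "e > 0"
  then have e: "e / 2 > 0" by simp
  have "\<forall>\<^sub>F k in sequentially. dist (p k) x < e / 2 \<and> dist (g k) \<xi> < e / 2"
    using tendstoD[OF assms(1) e] tendstoD[OF assms(2) e] by (rule eventually_conj)
  then obtain k where k: "dist (p k) x < e / 2" "dist (g k) \<xi> < e / 2"
    by (auto dest!: eventually_happens)
  obtain z G where "dist z (p k) < e / 2" "GDERIV f z :> G" "dist G (g k) < e / 2"
    using assms(3)[of k] e unfolding limiting_gradients_iff by blast
  with k show "\<exists>z G. dist z x < e \<and> GDERIV f z :> G \<and> dist G \<xi> < e"
    by (intro exI[of _ z] exI[of _ G]) (auto intro: dist_triangle_half_l simp: dist_commute)
qed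

lemma limiting_gradients_norm_le:
  assumes lip: "L-lipschitz_on S f" and "open S" "x \<in> S" and g: "g \<in> limiting_gradients f x"
  shows "norm g \<le> L"
proof -
  obtain z G where z: "z \<longlonglongrightarrow> x" "\<And>i. GDERIV f (z i) :> G i" and G: "G \<longlonglongrightarrow> g"
    using g by (auto simp: limiting_gradients_def)
  have "\<forall>\<^sub>F i in sequentially. z i \<in> S"
    using z(1) assms(2,3) by (rule topological_tendstoD)
  then have "\<forall>\<^sub>F i in sequentially. norm (G i) \<le> L"
    by eventually_elim (rule norm_GDERIV_le_lipschitz[OF lip \<open>open S\<close> _ z(2)])
  then show ?thesis
    by (intro tendsto_upperbound[OF tendsto_norm[OF G]]) auto
qed

lemma compact_limiting_gradients:
  assumes "L-lipschitz_on S f" "open S" "x \<in> S"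
  shows "compact (limiting_gradients f x)"
proof -
  have "closed (limiting_gradients f x)"
    unfolding closed_sequential_limits
    using limiting_gradients_closed_graph[OF tendsto_const] by blast
  moreover have "bounded (limiting_gradients f x)"
    using limiting_gradients_norm_le[OF assms] by (auto simp: bounded_iff)
  ultimately show ?thesis
    by (simp add: compact_eq_bounded_closed)
qed

text \<open>
  Limiting gradients at \<open>p k\<close> that stay away from those at \<open>x\<close> would be bounded by the Lipschitz
  constant, hence have a cluster point, which the closed graph puts among the limiting gradients
  at \<open>x\<close>.
\<close>

lemma limiting_gradients_upper_semicontinuous:
  assumes lip: "L-lipschitz_on S f" and "open S" "x \<in> S" and "p \<longlonglongrightarrow> x" and "e > 0"
  shows "\<forall>\<^sub>F k in sequentially. limiting_gradients f (p k) \<subseteq> limiting_gradients f x + cball 0 e"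
proof (rule ccontr)
  let ?bad = "\<lambda>k g. g \<in> limiting_gradients f (p k) \<and> g \<notin> limiting_gradients f x + cball 0 e"
  assume "\<not> ?thesis"
  moreover have "\<forall>\<^sub>F k in sequentially. p k \<in> S"
    using assms(4,2,3) by (rule topological_tendstoD)
  ultimately have "\<exists>\<^sub>F k in sequentially. (\<exists>g. ?bad k g) \<and> p k \<in> S"
    by (intro frequently_eventually_frequently) (simp_all add: not_eventually subset_iff)
  then have "infinite {k. (\<exists>g. ?bad k g) \<and> p k \<in> S}"
    by (simp add: frequently_cofinite flip: cofinite_eq_sequentially)
  then obtain r :: "nat \<Rightarrow> nat" where r: "strict_mono r"
      and "\<And>k. r k \<in> {k. (\<exists>g. ?bad k g) \<and> p k \<in> S}"
    using infinite_enumerate by blast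
  then obtain g where S: "\<And>k. p (r k) \<in> S" and g: "\<And>k. ?bad (r k) (g k)"
    unfolding mem_Collect_eq by metis
  have "\<And>k. norm (g k) \<le> L"
    using limiting_gradients_norm_le[OF lip \<open>open S\<close> S] g by blast
  then have "bounded (range g)"
    by (auto simp: bounded_iff)
  then obtain \<xi> q where q: "strict_mono (q::nat \<Rightarrow> nat)" "(g \<circ> q) \<longlonglongrightarrow> \<xi>"
    using bounded_imp_convergent_subsequence by blast
  have "(p \<circ> (r \<circ> q)) \<longlonglongrightarrow> x"
    using LIMSEQ_subseq_LIMSEQ[OF assms(4)] r q(1) by (simp add: strict_mono_o)
  then have \<xi>: "\<xi> \<in> limiting_gradients f x"
    using limiting_gradients_closed_graph[OF _ q(2), of "p \<circ> (r \<circ> q)"] g by simp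
  have "\<forall>\<^sub>F k in sequentially. dist ((g \<circ> q) k) \<xi> < e"
    using q(2) \<open>e > 0\<close> by (rule tendstoD)
  then obtain k where "dist (g (q k)) \<xi> < e"
    by (auto dest!: eventually_happens)
  then have "g (q k) - \<xi> \<in> cball 0 e"
    by (simp add: dist_norm norm_minus_commute)
  then have "\<xi> + (g (q k) - \<xi>) \<in> limiting_gradients f x + cball 0 e"
    using \<xi> by (rule set_plus_intro[rotated])
  with g[of "q k"] show False by simp
qed

section \<open>The extended generalized directional derivative\<close>

lemma eventually_nhds_times_at_right:
  fixes x :: "'a::metric_space"
  shows "eventually P (nhds x \<times>\<^sub>F at_right (0::real)) \<longleftrightarrow>
     (\<exists>e>0. \<forall>z t. dist z x < e \<longrightarrow> 0 < t \<longrightarrow> t < e \<longrightarrow> P (z, t))"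
proof
  assume "eventually P (nhds x \<times>\<^sub>F at_right (0::real))"
  then obtain Q T where "eventually Q (nhds x)" "eventually T (at_right 0)"
      and P: "\<And>z t. Q z \<Longrightarrow> T t \<Longrightarrow> P (z, t)"
    by (auto simp: eventually_prod_filter)
  then obtain d b where d: "d > 0" "\<And>z. dist z x < d \<Longrightarrow> Q z"
      and b: "b > 0" "\<And>t. 0 < t \<Longrightarrow> t < b \<Longrightarrow> T t"
    by (auto simp: eventually_nhds_metric eventually_at_right_field)
  then show "\<exists>e>0. \<forall>z t. dist z x < e \<longrightarrow> 0 < t \<longrightarrow> t < e \<longrightarrow> P (z, t)"
    by (intro exI[of _ "min d b"]) (auto intro: P)
next
  assume "\<exists>e>0. \<forall>z t. dist z x < e \<longrightarrow> 0 < t \<longrightarrow> t < e \<longrightarrow> P (z, t)"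
  then obtain e where "e > 0" "\<And>z t. dist z x < e \<Longrightarrow> 0 < t \<Longrightarrow> t < e \<Longrightarrow> P (z, t)"
    by blast
  then show "eventually P (nhds x \<times>\<^sub>F at_right (0::real))"
    unfolding eventually_prod_filter
    by (intro exI[of _ "\<lambda>z. dist z x < e"] exI[of _ "\<lambda>t. 0 < t \<and> t < e"])
       (auto simp: eventually_nhds_metric eventually_at_right_field)
qed

lemma le_Limsup_iff:
  fixes f :: "'a \<Rightarrow> 'b::complete_linorder"
  shows "C \<le> Limsup F f \<longleftrightarrow> (\<forall>c<C. \<exists>\<^sub>F p in F. c < f p)"
proof (intro iffI allI impI)
  fix c assume "C \<le> Limsup F f" "c < C"
  then have "\<not> (\<forall>\<^sub>F p in F. f p \<le> c)"
    using Limsup_bounded[of f c F] by auto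
  then show "\<exists>\<^sub>F p in F. c < f p"
    by (simp add: frequently_def not_less)
next
  assume freq: "\<forall>c<C. \<exists>\<^sub>F p in F. c < f p"
  have "C \<le> Sup (f ` Collect P)" if P: "eventually P F" for P
    unfolding le_SUP_iff
  proof (intro allI impI)
    fix c assume "c < C"
    with freq have "\<exists>\<^sub>F p in F. c < f p \<and> P p"
      using P by (auto intro: frequently_eventually_frequently)
    then show "\<exists>p\<in>Collect P. c < f p"
      by (auto dest!: frequently_ex)
  qed
  then show "C \<le> Limsup F f"
    unfolding Limsup_def by (auto intro!: INF_greatest)
qed

text \<open>
  The defining limes superior is over pairs near \<open>(x, 0)\<close> in which the base point varies.  Spelled
  out with a radius, its upper semicontinuity becomes a matter of shrinking balls.
\<close>

lemma le_clarke_dderiv_iff: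
  "ereal c \<le> clarke_dderiv f x v \<longleftrightarrow>
     (\<forall>c'<c. \<forall>e>0. \<exists>z t. dist z x < e \<and> 0 < t \<and> t < e \<and> c' < (f (z + t *\<^sub>R v) - f z) / t)"
  (is "_ \<longleftrightarrow> (\<forall>c'<c. ?often c')")
proof -
  let ?F = "nhds x \<times>\<^sub>F at_right (0::real)"
  let ?q = "\<lambda>(z, t). ereal ((f (z + t *\<^sub>R v) - f z) / t)"
  have freq: "(\<exists>\<^sub>F p in ?F. ereal c' < ?q p) \<longleftrightarrow> ?often c'" for c'
    by (simp add: frequently_def eventually_nhds_times_at_right not_less) (meson not_less)
  have "ereal c \<le> clarke_dderiv f x v \<longleftrightarrow> (\<forall>c'<ereal c. \<exists>\<^sub>F p in ?F. c' < ?q p)"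
    unfolding clarke_dderiv_def le_Limsup_iff ..
  also have "\<dots> \<longleftrightarrow> (\<forall>c'<c. \<exists>\<^sub>F p in ?F. ereal c' < ?q p)"
  proof (intro iffI allI impI)
    fix c' assume real: "\<forall>c'<c. \<exists>\<^sub>F p in ?F. ereal c' < ?q p" and "c' < ereal c"
    then obtain b where "c' \<le> ereal b" "b < c"
      using ereal_dense2[of c' "ereal c"] by (auto intro: less_imp_le)
    then have "\<exists>\<^sub>F p in ?F. ereal b < ?q p"
      using real by blast
    then show "\<exists>\<^sub>F p in ?F. c' < ?q p"
      by (rule frequently_elim1) (rule le_less_trans[OF \<open>c' \<le> ereal b\<close>])
  qed auto
  finally show ?thesis
    unfolding freq .
qed

text \<open>
  A base point close to \<open>p k\<close> is also close to \<open>x\<close>, so every large quotient near \<open>p k\<close> counts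
  at \<open>x\<close> as well.
\<close>

lemma clarke_dderiv_upper_semicontinuous:
  assumes "p \<longlonglongrightarrow> x" "c \<longlonglongrightarrow> c0" "\<And>k. ereal (c k) \<le> clarke_dderiv f (p k) v"
  shows "ereal c0 \<le> clarke_dderiv f x v"
  unfolding le_clarke_dderiv_iff
proof (intro allI impI)
  fix c' e :: real assume "c' < c0" and "e > 0"
  then have e: "e / 2 > 0" by simp
  have "\<forall>\<^sub>F k in sequentially. dist (p k) x < e / 2 \<and> c' < c k"
    using tendstoD[OF assms(1) e] order_tendstoD(1)[OF assms(2) \<open>c' < c0\<close>]
    by (rule eventually_conj)
  then obtain k where k: "dist (p k) x < e / 2" "c' < c k"
    by (auto dest!: eventually_happens)
  obtain z t where "dist z (p k) < e / 2" "0 < t" "t < e / 2"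
      "c' < (f (z + t *\<^sub>R v) - f z) / t"
    using assms(3)[of k] k(2) e unfolding le_clarke_dderiv_iff by blast
  with k show "\<exists>z t. dist z x < e \<and> 0 < t \<and> t < e \<and> c' < (f (z + t *\<^sub>R v) - f z) / t"
    by (intro exI[of _ z] exI[of _ t]) (auto intro: dist_triangle_half_l simp: dist_commute)
qed

lemma GDERIV_le_clarke_dderiv:
  assumes "GDERIV f z :> G"
  shows "ereal (G \<bullet> v) \<le> clarke_dderiv f z v"
  unfolding le_clarke_dderiv_iff
proof (intro allI impI)
  fix c e :: real assume "c < G \<bullet> v" "e > 0"
  have "\<forall>\<^sub>F t in at_right 0. c < (f (z + t *\<^sub>R v) - f z) / t"
    using GDERIV_imp_quotient_tendsto[OF assms] \<open>c < G \<bullet> v\<close> by (rule order_tendstoD)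
  moreover have "\<forall>\<^sub>F t in at_right 0. 0 < t \<and> t < e"
    using \<open>e > 0\<close> by (auto simp: eventually_at_right_field)
  ultimately have "\<forall>\<^sub>F t in at_right 0. 0 < t \<and> t < e \<and> c < (f (z + t *\<^sub>R v) - f z) / t"
    by eventually_elim auto
  then have "\<exists>t. 0 < t \<and> t < e \<and> c < (f (z + t *\<^sub>R v) - f z) / t"
    by (auto dest!: eventually_happens)
  with \<open>e > 0\<close> show "\<exists>z' t. dist z' z < e \<and> 0 < t \<and> t < e \<and> c < (f (z' + t *\<^sub>R v) - f z') / t"
    by (intro exI[of _ z]) auto
qed

lemma convex_clarke_dderiv_set: "convex {\<xi>. \<forall>v. ereal (\<xi> \<bullet> v) \<le> clarke_dderiv f x v}"
proof -
  have "convex {\<xi>. ereal (\<xi> \<bullet> v) \<le> clarke_dderiv f x v}" for v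
    using convex_halfspace_le[of v] by (cases "clarke_dderiv f x v") (auto simp: inner_commute)
  then show ?thesis
    by (auto simp: Collect_all_eq intro: convex_INT)
qed

text \<open>
  The easy half of the equivalence between the gradient formula and the directional derivative
  at points of local Lipschitz continuity.  It puts all members of a sequence of generalized gradients
  under one description, whichever case of the definition each of them comes from.
\<close>

lemma clarke_gradient_le_clarke_dderiv:
  assumes "\<xi> \<in> clarke_gradient f x"
  shows "ereal (\<xi> \<bullet> v) \<le> clarke_dderiv f x v"
proof (cases "locally_lipschitz_at f x")
  case True
  have "ereal (g \<bullet> w) \<le> clarke_dderiv f x w" if g: "g \<in> limiting_gradients f x" for g w
  proof -
    obtain z G where "z \<longlonglongrightarrow> x" "\<And>i. GDERIV f (z i) :> G i" "G \<longlonglongrightarrow> g"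
      using g by (auto simp: limiting_gradients_def)
    then show ?thesis
      by (intro clarke_dderiv_upper_semicontinuous[of z x "\<lambda>i. G i \<bullet> w"] tendsto_intros
          GDERIV_le_clarke_dderiv)
  qed
  then have "convex hull limiting_gradients f x \<subseteq> {\<xi>. \<forall>v. ereal (\<xi> \<bullet> v) \<le> clarke_dderiv f x v}"
    by (intro hull_minimal convex_clarke_dderiv_set) auto
  with assms True show ?thesis
    by (auto simp: clarke_gradient_def)
qed (use assms in \<open>simp add: clarke_gradient_def\<close>)

section \<open>The Clarke gradient has a closed graph\<close>

text \<open>
  If \<open>f\<close> is Lipschitz near \<open>x\<close>, then it is so near \<open>p k\<close> for large \<open>k\<close>, and the convex hull at \<open>p k\<close>
  lies in the \<open>e\<close>-neighbourhood of the compact convex hull at \<open>x\<close>.  Otherwise membership at \<open>x\<close>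
  is a family of inequalities for the directional derivative, which pass to the limit.
\<close>

lemma clarke_gradient_closed_graph:
  assumes p: "p \<longlonglongrightarrow> x" and g: "g \<longlonglongrightarrow> \<xi>" and mem: "\<And>k. g k \<in> clarke_gradient f (p k)"
  shows "\<xi> \<in> clarke_gradient f x"
proof (cases "locally_lipschitz_at f x")
  case False
  have "ereal (\<xi> \<bullet> v) \<le> clarke_dderiv f x v" for v
    by (rule clarke_dderiv_upper_semicontinuous[OF p, of "\<lambda>k. g k \<bullet> v"])
       (auto intro!: tendsto_intros g clarke_gradient_le_clarke_dderiv mem)
  with False show ?thesis
    by (simp add: clarke_gradient_def)
next
  case True
  then obtain r L where "r > 0" and lip: "L-lipschitz_on (ball x r) f"
    by (auto simp: locally_lipschitz_at_def)
  then have x: "x \<in> ball x r" by simp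
  let ?K = "limiting_gradients f x"
  let ?C = "convex hull ?K"
  have "compact ?C"
    by (intro compact_convex_hull compact_limiting_gradients[OF lip open_ball x])
  have loc: "locally_lipschitz_at f z" if z: "z \<in> ball x r" for z
  proof -
    obtain d where "d > 0" "ball z d \<subseteq> ball x r"
      by (rule openE[OF open_ball z])
    then show ?thesis
      unfolding locally_lipschitz_at_def using lipschitz_on_subset[OF lip] by blast
  qed
  have near: "\<xi> \<in> ?C + cball 0 e" if "e > 0" for e
  proof -
    have "\<forall>\<^sub>F k in sequentially. p k \<in> ball x r"
      using p open_ball x by (rule topological_tendstoD)
    moreover have "\<forall>\<^sub>F k in sequentially. limiting_gradients f (p k) \<subseteq> ?K + cball 0 e"
      by (rule limiting_gradients_upper_semicontinuous[OF lip open_ball x p \<open>e > 0\<close>])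
    ultimately have "\<forall>\<^sub>F k in sequentially. g k \<in> ?C + cball 0 e"
    proof eventually_elim
      case (elim k)
      have "g k \<in> convex hull limiting_gradients f (p k)"
        using mem[of k] loc[OF elim(1)] by (simp add: clarke_gradient_def)
      also have "\<dots> \<subseteq> convex hull (?K + cball 0 e)"
        using elim(2) by (rule hull_mono)
      also have "\<dots> = ?C + cball 0 e"
        by (simp add: convex_hull_set_plus hull_same)
      finally show ?case .
    qed
    moreover have "closed (?C + cball 0 e)"
    proof -
      have sums: "?C + cball 0 e = {a + b | a b. a \<in> ?C \<and> b \<in> cball 0 e}"
        unfolding set_plus_def by blast
      show ?thesis
        unfolding sums by (rule compact_imp_closed[OF compact_sums[OF \<open>compact ?C\<close> compact_cball]])
    qed
    ultimately show ?thesis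
      by (rule Lim_in_closed_set[OF _ _ sequentially_bot g, rotated])
  qed
  have "\<xi> \<in> closure ?C"
    unfolding closure_approachable
  proof (intro allI impI)
    fix e :: real assume "e > 0"
    then obtain a b where "a \<in> ?C" "norm b \<le> e / 2" "\<xi> = a + b"
      using near[of "e / 2"] by (auto simp: set_plus_def)
    with \<open>e > 0\<close> show "\<exists>a\<in>?C. dist a \<xi> < e"
      by (intro bexI[of _ a]) (auto simp: dist_norm)
  qed
  then show ?thesis
    unfolding closure_closed[OF compact_imp_closed[OF \<open>compact ?C\<close>]]
    by (simp only: clarke_gradient_def True if_True)
qed

section \<open>Values of the objective\<close>

lemma order_stat_mem_range:
  fixes y :: "real ^ 'n::finite"
  assumes "i \<in> {1..CARD('n)}"
  shows "order_stat y i \<in> range (\<lambda>j. y $ j)"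
proof -
  let ?xs = "sorted_list_of_multiset (image_mset (\<lambda>j. y $ j) (mset_set (UNIV :: 'n set)))"
  have "length ?xs = CARD('n)"
    by (metis mset_sorted_list_of_multiset size_image_mset size_mset size_mset_set)
  then have "?xs ! (i - 1) \<in> set ?xs"
    using assms by (intro nth_mem) auto
  then show ?thesis
    by (simp add: order_stat_def)
qed

text \<open>
  A compactness argument is not available, since \<open>Omega\<close> may jump when an entry crosses \<open>B\<close>: if
  \<open>U B \<noteq> 0\<close>, different weights on the two sides make it discontinuous there.  Instead,
  monotonicity bounds \<open>U\<close> on the interval that contains all entries.
\<close>

lemma Omega_bounded_below:
  fixes S :: "(real ^ 'n::finite) set"
  assumes "mono U" "bounded S"
  obtains m where "\<And>y. y \<in> S \<Longrightarrow> m \<le> Omega B U wm wp y"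
proof -
  obtain M where M: "\<And>y. y \<in> S \<Longrightarrow> norm y \<le> M"
    using \<open>bounded S\<close> by (auto simp: bounded_iff)
  define C where "C = max \<bar>U (- M)\<bar> \<bar>U M\<bar>"
  let ?w = "\<lambda>i. \<bar>weight_loss wm CARD('n) i\<bar> + \<bar>weight_gain wp CARD('n) i\<bar>"
  show thesis
  proof
    fix y assume "y \<in> S"
    have U: "\<bar>U (order_stat y i)\<bar> \<le> C" if i: "i \<in> {1..CARD('n)}" for i
    proof -
      obtain j where "order_stat y i = y $ j"
        using order_stat_mem_range[OF i] by blast
      then have "\<bar>order_stat y i\<bar> \<le> M"
        using component_le_norm_cart[of y j] M[OF \<open>y \<in> S\<close>] by simp
      then have "U (- M) \<le> U (order_stat y i)" "U (order_stat y i) \<le> U M"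
        by (auto intro!: monoD[OF \<open>mono U\<close>])
      then show ?thesis
        by (auto simp: C_def)
    qed
    have "Omega B U wm wp y \<ge> - (\<Sum>i = 1..CARD('n). ?w i * C)"
      unfolding Omega_def neg_le_iff_le
    proof (rule sum_mono)
      fix i assume i: "i \<in> {1..CARD('n)}"
      let ?c = "if order_stat y i \<le> B then weight_loss wm CARD('n) i
                else weight_gain wp CARD('n) i"
      have "?c * U (order_stat y i) \<le> \<bar>?c\<bar> * \<bar>U (order_stat y i)\<bar>"
        by (metis abs_ge_self abs_mult)
      also have "\<dots> \<le> ?w i * C"
        using U[OF i] by (intro mult_mono) auto
      finally show "?c * U (order_stat y i) \<le> ?w i * C" .
    qed
    then show "- (\<Sum>i = 1..CARD('n). ?w i * C) \<le> Omega B U wm wp y" .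
  qed
qed

section \<open>Descent of the augmented Lagrangian\<close>

definition lagrangian_value ::
  "(real ^ 'n \<Rightarrow> real) \<Rightarrow> real ^ 'd ^ 'n \<Rightarrow> real
     \<Rightarrow> real ^ 'd \<Rightarrow> real ^ 'n \<Rightarrow> real ^ 'n \<Rightarrow> real" where
  "lagrangian_value \<Omega> R \<sigma> x y l =
     \<Omega> y + l \<bullet> (y - R *v x) + \<sigma> / 2 * (norm (y - R *v x))\<^sup>2"

lemma aug_lagrangian_feasible:
  "x \<in> X \<Longrightarrow> aug_lagrangian \<Omega> X R \<sigma> x y l = ereal (lagrangian_value \<Omega> R \<sigma> x y l)"
  by (simp add: aug_lagrangian_def lagrangian_value_def set_indicator_def)

text \<open>
  The objective of the \<open>x\<close>-step is quadratic in \<open>R x\<close>, so its second-order expansion is exact.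
  At a minimizer over a convex set the linear term has a sign, and the last term is the least by
  which any other feasible point \<open>x'\<close> exceeds the minimum.
\<close>

lemma lagrangian_value_expand:
  fixes R :: "real ^ 'd::finite ^ 'n::finite"
  shows "lagrangian_value \<Omega> R \<sigma> x' y l = lagrangian_value \<Omega> R \<sigma> x y l
     - (l + \<sigma> *\<^sub>R (y - R *v x)) \<bullet> (R *v (x' - x)) + \<sigma> / 2 * (norm (R *v (x' - x)))\<^sup>2"
proof -
  define u d where "u = y - R *v x" and "d = R *v (x' - x)"
  have x': "y - R *v x' = u - d"
    by (simp add: u_def d_def matrix_vector_mult_diff_distrib)
  have "lagrangian_value \<Omega> R \<sigma> x' y l
      = \<Omega> y + l \<bullet> u + \<sigma> / 2 * (norm u)\<^sup>2 - (l + \<sigma> *\<^sub>R u) \<bullet> d + \<sigma> / 2 * (norm d)\<^sup>2"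
    unfolding lagrangian_value_def x' power2_norm_eq_inner
    by (simp add: algebra_simps inner_commute)
  then show ?thesis
    by (simp add: lagrangian_value_def u_def d_def)
qed

text \<open>
  Moving from the minimizer towards \<open>x'\<close> by a fraction \<open>t\<close> changes the value by a linear term of
  order \<open>t\<close> and a quadratic one of order \<open>t\<^sup>2\<close>; the linear one must be nonnegative.
\<close>

lemma minimizer_variational_inequality:
  fixes R :: "real ^ 'd::finite ^ 'n::finite"
  assumes "convex X" "x \<in> X" "x' \<in> X"
    and min: "\<And>z. z \<in> X \<Longrightarrow> lagrangian_value \<Omega> R \<sigma> x y l \<le> lagrangian_value \<Omega> R \<sigma> z y l"
  shows "(l + \<sigma> *\<^sub>R (y - R *v x)) \<bullet> (R *v (x' - x)) \<le> 0"
proof -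
  define d where "d = R *v (x' - x)"
  define w where "w = l + \<sigma> *\<^sub>R (y - R *v x)"
  have le: "w \<bullet> d \<le> t * (\<sigma> / 2 * (norm d)\<^sup>2)" if t: "0 < t" "t < 1" for t
  proof -
    have "x + t *\<^sub>R (x' - x) \<in> X"
      using convexD_alt[OF assms(1-3), of t] t by (simp add: algebra_simps)
    from min[OF this] have "0 \<le> - (w \<bullet> (t *\<^sub>R d)) + \<sigma> / 2 * (norm (t *\<^sub>R d))\<^sup>2"
      unfolding lagrangian_value_expand[of \<Omega> R \<sigma> "x + t *\<^sub>R (x' - x)" y l x]
      by (simp add: w_def d_def matrix_vector_mult_scaleR)
    then have "t * (w \<bullet> d) \<le> t * (t * (\<sigma> / 2 * (norm d)\<^sup>2))"
      by (simp add: power_mult_distrib power2_eq_square algebra_simps)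
    then show ?thesis
      using t by simp
  qed
  have "((\<lambda>t. t * (\<sigma> / 2 * (norm d)\<^sup>2)) \<longlongrightarrow> 0 * (\<sigma> / 2 * (norm d)\<^sup>2)) (at_right 0)"
    by (intro tendsto_intros)
  moreover have "\<forall>\<^sub>F t in at_right 0. w \<bullet> d \<le> t * (\<sigma> / 2 * (norm d)\<^sup>2)"
    unfolding eventually_at_right_field by (intro exI[of _ 1] conjI allI impI zero_less_one le)
  ultimately have "w \<bullet> d \<le> 0 * (\<sigma> / 2 * (norm d)\<^sup>2)"
    by (rule tendsto_lowerbound) simp
  then show ?thesis
    by (simp add: w_def d_def)
qed

lemma admm_x_update_minimizes:
  assumes "admm_sequence \<Omega> X R \<sigma> x y l" "z \<in> X"
  shows "lagrangian_value \<Omega> R \<sigma> (x (Suc k)) (y k) (l k) \<le> lagrangian_value \<Omega> R \<sigma> z (y k) (l k)"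
proof -
  have "x (Suc k) \<in> X"
    and "aug_lagrangian \<Omega> X R \<sigma> (x (Suc k)) (y k) (l k) \<le> aug_lagrangian \<Omega> X R \<sigma> z (y k) (l k)"
    using assms by (auto simp: admm_sequence_def)
  then show ?thesis
    using \<open>z \<in> X\<close> by (simp add: aug_lagrangian_feasible)
qed

lemma summable_of_perturbed_descent:
  fixes V a b :: "nat \<Rightarrow> real"
  assumes step: "\<And>k. V (Suc k) + a k \<le> V k + b k" and lower: "\<And>k. m \<le> V k"
    and "\<And>k. 0 \<le> a k" "\<And>k. 0 \<le> b k" "summable b"
  shows "summable a"
proof (rule summableI_nonneg_bounded)
  fix n
  have "V n + sum a {..<n} \<le> V 0 + sum b {..<n}"
  proof (induction n)
    case (Suc n)
    then show ?case using step[of n] by simp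
  qed simp
  moreover have "sum b {..<n} \<le> suminf b"
    using assms(4,5) by (intro sum_le_suminf) auto
  ultimately show "sum a {..<n} \<le> V 0 + suminf b - m"
    using lower[of n] by linarith
qed fact

text \<open>
  The second conclusion is the sufficient-decrease argument.  It runs from index 1 on: the initial
  point \<open>x 0\<close> is arbitrary and may be infeasible, so the first decrease that can be estimated is
  the one between \<open>x 1\<close> and \<open>x 2\<close>.
\<close>

lemma admm_y_steps_tendsto_zero:
  fixes R :: "real ^ 'd::finite ^ 'n::finite"
  assumes "\<sigma> > 0" "convex X" "compact X" and admm: "admm_sequence \<Omega> X R \<sigma> x y l"
    and "bounded (range l)" and sum: "summable (\<lambda>k. (norm (l (Suc k) - l k))\<^sup>2)"
    and y_upd: "y_update_cond \<Omega> X R \<sigma> x y l"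
    and below: "\<And>S. bounded S \<Longrightarrow> \<exists>m. \<forall>z\<in>S. m \<le> \<Omega> z"
  shows "(\<lambda>k. y (Suc k) - R *v x (Suc k)) \<longlonglongrightarrow> 0" "(\<lambda>k. y (Suc k) - y k) \<longlonglongrightarrow> 0"
proof -
  let ?res = "\<lambda>k. y (Suc k) - R *v x (Suc k)"
  have xX: "x (Suc k) \<in> X" for k
    using admm by (simp add: admm_sequence_def)
  have dl: "l (Suc k) = l k + \<sigma> *\<^sub>R ?res k" for k
    using admm by (simp add: admm_sequence_def)
  have res: "?res k = (1 / \<sigma>) *\<^sub>R (l (Suc k) - l k)" for k
    using \<open>\<sigma> > 0\<close> by (simp add: dl)
  have "(\<lambda>k. norm (l (Suc k) - l k) ^ 2) \<longlonglongrightarrow> 0"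
    using sum by (rule summable_LIMSEQ_zero)
  then have "(\<lambda>k. l (Suc k) - l k) \<longlonglongrightarrow> 0"
    by (simp add: tendsto_norm_zero_iff)
  then show res0: "?res \<longlonglongrightarrow> 0"
    unfolding res using tendsto_scaleR[OF tendsto_const, of _ 0 _ "1 / \<sigma>"] by simp

  have "bounded ((\<lambda>u. R *v u) ` X)"
    using \<open>compact X\<close> by (intro compact_imp_bounded compact_continuous_image
        linear_continuous_on matrix_vector_mul_bounded_linear)
  moreover have "bounded (range ?res)"
    using res0 by (intro convergent_imp_bounded)
  ultimately obtain C M' where C: "\<And>u. u \<in> X \<Longrightarrow> norm (R *v u) \<le> C"
      and M': "\<And>k. norm (?res k) \<le> M'"
    by (auto simp: bounded_iff)
  have "norm (y (Suc k)) \<le> C + M'" for k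
    using norm_triangle_ineq[of "R *v x (Suc k)" "?res k"] C[OF xX, of k] M'[of k] by simp
  then have "bounded (range (\<lambda>k. y (Suc k)))"
    unfolding bounded_iff by blast
  then obtain m where m: "\<And>k. m \<le> \<Omega> (y (Suc k))"
    using below[OF \<open>bounded (range (\<lambda>k. y (Suc k)))\<close>] by auto
  obtain M where M: "\<And>k. norm (l k) \<le> M"
    using \<open>bounded (range l)\<close> by (auto simp: bounded_iff)

  define V where "V k = lagrangian_value \<Omega> R \<sigma> (x (Suc k)) (y (Suc k)) (l (Suc k))" for k
  let ?dx = "\<lambda>k. R *v (x (Suc (Suc k)) - x (Suc k))"
  have lower: "m - M * M' \<le> V k" for k
  proof -
    have "\<bar>l (Suc k) \<bullet> ?res k\<bar> \<le> norm (l (Suc k)) * norm (?res k)"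
      by (rule Cauchy_Schwarz_ineq2)
    also have "\<dots> \<le> M * M'"
      using M[of "Suc k"] M'[of k] by (intro mult_mono) (auto intro: order_trans[OF norm_ge_zero])
    finally have "- (M * M') \<le> l (Suc k) \<bullet> ?res k"
      by linarith
    moreover have "0 \<le> \<sigma> / 2 * (norm (?res k))\<^sup>2"
      using \<open>\<sigma> > 0\<close> by simp
    ultimately show ?thesis
      unfolding V_def lagrangian_value_def using m[of k] by linarith
  qed
  have descent: "V (Suc k) + \<sigma> / 2 * (norm (?dx k))\<^sup>2
      \<le> V k + (norm (l (Suc (Suc k)) - l (Suc k)))\<^sup>2 / \<sigma>" for k
  proof -
    let ?L = "lagrangian_value \<Omega> R \<sigma>"
    let ?x' = "x (Suc (Suc k))" and ?y' = "y (Suc (Suc k))" and ?l' = "l (Suc (Suc k))"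
    let ?x = "x (Suc k)" and ?y = "y (Suc k)" and ?l = "l (Suc k)"
    have x_min: "?L ?x' ?y ?l \<le> ?L z ?y ?l" if "z \<in> X" for z
      using admm that by (rule admm_x_update_minimizes)
    have "?L ?x' ?y ?l + \<sigma> / 2 * (norm (?dx k))\<^sup>2 \<le> ?L ?x ?y ?l"
    proof -
      have "norm (R *v (?x - ?x')) = norm (?dx k)"
        by (simp add: matrix_vector_mult_diff_distrib norm_minus_commute)
      then show ?thesis
        using minimizer_variational_inequality[OF \<open>convex X\<close> xX xX x_min, of k]
          lagrangian_value_expand[of \<Omega> R \<sigma> ?x ?y ?l ?x'] by simp
    qed
    moreover have "?L ?x' ?y' ?l \<le> ?L ?x' ?y ?l"
    proof -
      have "0 \<le> aug_lagrangian \<Omega> X R \<sigma> ?x' ?y ?l - aug_lagrangian \<Omega> X R \<sigma> ?x' ?y' ?l"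
        using y_upd by (simp add: y_update_cond_def)
      then show ?thesis
        unfolding aug_lagrangian_feasible[OF xX] by simp
    qed
    moreover have "?L ?x' ?y' ?l' = ?L ?x' ?y' ?l + (norm (?l' - ?l))\<^sup>2 / \<sigma>"
    proof -
      have "(?l' - ?l) \<bullet> ?res (Suc k) = (norm (?l' - ?l))\<^sup>2 / \<sigma>"
        unfolding res by (simp add: power2_norm_eq_inner)
      then show ?thesis
        by (simp add: lagrangian_value_def inner_diff_left)
    qed
    ultimately show ?thesis
      by (simp add: V_def)
  qed
  have "summable (\<lambda>k. (norm (l (Suc (Suc k)) - l (Suc k)))\<^sup>2 / \<sigma>)"
    using sum by (intro summable_divide) (subst summable_Suc_iff)
  then have "summable (\<lambda>k. \<sigma> / 2 * (norm (?dx k))\<^sup>2)"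
    using \<open>\<sigma> > 0\<close>
    by (intro summable_of_perturbed_descent[where V = V
          and a = "\<lambda>k. \<sigma> / 2 * (norm (?dx k))\<^sup>2", OF descent lower]) auto
  then have "(\<lambda>k. \<sigma> / 2 * (norm (?dx k))\<^sup>2) \<longlonglongrightarrow> 0"
    by (rule summable_LIMSEQ_zero)
  then have "?dx \<longlonglongrightarrow> 0"
    using \<open>\<sigma> > 0\<close> by (simp add: tendsto_mult_left_iff tendsto_norm_zero_iff)
  \<comment> \<open>A step in \<open>y\<close> is the step in \<open>R x\<close> plus the change of the residual.\<close>
  then have "(\<lambda>k. ?dx k + ?res (Suc k) - ?res k) \<longlonglongrightarrow> 0 + 0 - 0"
    by (intro tendsto_intros res0 LIMSEQ_Suc[OF res0])
  then have "(\<lambda>k. y (Suc (Suc k)) - y (Suc k)) \<longlonglongrightarrow> 0"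
    by (simp add: matrix_vector_mult_diff_distrib)
  then show "(\<lambda>k. y (Suc k) - y k) \<longlonglongrightarrow> 0"
    by (rule LIMSEQ_imp_Suc)
qed

section \<open>Stationarity of accumulation points\<close>

theorem theorem1:
  fixes B \<sigma> :: real and U wm wp :: "real \<Rightarrow> real"
    and R :: "real ^ 'd::finite ^ 'n::finite"
    and X :: "(real ^ 'd) set"
    and x :: "nat \<Rightarrow> real ^ 'd" and y l :: "nat \<Rightarrow> real ^ 'n"
    and xs :: "real ^ 'd" and ys :: "real ^ 'n"
  assumes "S_shaped_utility B U"
    and "prob_weighting wm" and "prob_weighting wp"
    and "\<forall>i\<in>{1..CARD('n)}. weight_loss wm CARD('n) i > 0 \<and> weight_gain wp CARD('n) i > 0"
    and "\<sigma> > 0"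
    and "positive_definite (transpose R ** R)"
    and "convex X" and "compact X"
    and "admm_sequence (Omega B U wm wp) X R \<sigma> x y l"
    and "bounded (range l)"
    and "summable (\<lambda>k. (norm (l (Suc k) - l k))\<^sup>2)"
    and "y_update_cond (Omega B U wm wp) X R \<sigma> x y l"
    and "accumulation_point (\<lambda>k. (x k, y k)) (xs, ys)"
  shows "0 \<in> (\<lambda>g. transpose R *v g) ` clarke_gradient (Omega B U wm wp) ys + normal_cone X xs
       \<and> ys = R *v xs
       \<and> 0 \<in> (\<lambda>g. transpose R *v g) ` clarke_gradient (Omega B U wm wp) (R *v xs)
             + normal_cone X xs"
proof -
  let ?\<Omega> = "Omega B U wm wp :: real ^ 'n \<Rightarrow> real"
  have "mono U"
    using assms(1) by (simp add: S_shaped_utility_def strict_mono_mono)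
  then have below: "\<exists>m. \<forall>z\<in>S. m \<le> ?\<Omega> z" if "bounded S" for S
    using Omega_bounded_below[OF _ that] by metis
  have res0: "(\<lambda>k. y (Suc k) - R *v x (Suc k)) \<longlonglongrightarrow> 0" and dy0: "(\<lambda>k. y (Suc k) - y k) \<longlonglongrightarrow> 0"
    using admm_y_steps_tendsto_zero[OF assms(5,7-12) below] by blast+

  have xX: "x (Suc k) \<in> X" for k
    using assms(9) by (simp add: admm_sequence_def)
  have dl: "l (Suc k) = l k + \<sigma> *\<^sub>R (y (Suc k) - R *v x (Suc k))" for k
    using assms(9) by (simp add: admm_sequence_def)
  have grad: "- l (Suc k) \<in> clarke_gradient ?\<Omega> (y (Suc k))" for k
  proof -
    have "0 \<in> clarke_gradient ?\<Omega> (y (Suc k))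
        + {\<sigma> *\<^sub>R (y (Suc k) - R *v x (Suc k) + (1 / \<sigma>) *\<^sub>R l k)}"
      using assms(12) by (simp add: y_update_cond_def)
    moreover have "\<sigma> *\<^sub>R (y (Suc k) - R *v x (Suc k) + (1 / \<sigma>) *\<^sub>R l k) = l (Suc k)"
      using \<open>\<sigma> > 0\<close> by (simp add: dl scaleR_add_right)
    ultimately show ?thesis
      by (auto simp: set_plus_def eq_commute[of 0] simp flip: eq_neg_iff_add_eq_0)
  qed
  \<comment> \<open>The \<open>x\<close>-step saw the old \<open>y k\<close>; replacing it by \<open>y (Suc k)\<close> turns the expression into the new
    multiplier, at the price of the difference of the two.\<close>
  have normal: "(l (Suc k) - \<sigma> *\<^sub>R (y (Suc k) - y k)) \<bullet> (R *v (z - x (Suc k))) \<le> 0"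
    if "z \<in> X" for z k
  proof -
    have "(l k + \<sigma> *\<^sub>R (y k - R *v x (Suc k))) \<bullet> (R *v (z - x (Suc k))) \<le> 0"
      by (rule minimizer_variational_inequality[OF assms(7) xX that
            admm_x_update_minimizes[OF assms(9)]])
    then show ?thesis
      by (simp add: dl algebra_simps)
  qed

  obtain r where r: "strict_mono r" "((\<lambda>k. (x k, y k)) \<circ> r) \<longlonglongrightarrow> (xs, ys)"
    using assms(13) by (auto simp: accumulation_point_def)
  have "bounded (range (l \<circ> r))"
    using assms(10) by (rule bounded_subset) auto
  then obtain ls q where q: "strict_mono (q :: nat \<Rightarrow> nat)" "(l \<circ> r \<circ> q) \<longlonglongrightarrow> ls"
    using bounded_imp_convergent_subsequence by blast
  \<comment> \<open>The optimality conditions describe iterates of positive index.  Dropping the first term of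
    the subsequence makes every index a successor.\<close>
  define j where "j k = r (q (Suc k)) - 1" for k
  have rq: "strict_mono (r \<circ> q)"
    using r(1) q(1) by (rule strict_mono_o)
  then have j: "r (q (Suc k)) = Suc (j k)" for k
    using strict_mono_imp_increasing[OF rq, of "Suc k"] by (simp add: j_def)
  have j_mono: "strict_mono j"
    using rq j by (simp add: strict_mono_Suc_iff) (metis Suc_less_eq comp_apply)
  have "((\<lambda>k. (x k, y k)) \<circ> r \<circ> q \<circ> Suc) \<longlonglongrightarrow> (xs, ys)"
    by (intro LIMSEQ_subseq_LIMSEQ[OF LIMSEQ_subseq_LIMSEQ[OF r(2) q(1)]]) (simp add: strict_mono_Suc_iff)
  then have xy: "(\<lambda>k. (x (Suc (j k)), y (Suc (j k)))) \<longlonglongrightarrow> (xs, ys)"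
    by (simp add: o_def j)
  have x_lim: "(\<lambda>k. x (Suc (j k))) \<longlonglongrightarrow> xs"
    using tendsto_fst[OF xy] by simp
  have y_lim: "(\<lambda>k. y (Suc (j k))) \<longlonglongrightarrow> ys"
    using tendsto_snd[OF xy] by simp
  have l_lim: "(\<lambda>k. l (Suc (j k))) \<longlonglongrightarrow> ls"
    using LIMSEQ_Suc[OF q(2)] by (simp add: o_def j)
  have R_lim: "(\<lambda>k. R *v u k) \<longlonglongrightarrow> R *v a" if "u \<longlonglongrightarrow> a" for u a
    using bounded_linear.tendsto[OF matrix_vector_mul_bounded_linear that] .

  have "(\<lambda>k. y (Suc (j k)) - R *v x (Suc (j k))) \<longlonglongrightarrow> 0"
    using LIMSEQ_subseq_LIMSEQ[OF res0 j_mono] by (simp add: o_def)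
  moreover have "(\<lambda>k. y (Suc (j k)) - R *v x (Suc (j k))) \<longlonglongrightarrow> ys - R *v xs"
    by (intro tendsto_intros y_lim R_lim x_lim)
  ultimately have feasible: "ys = R *v xs"
    using LIMSEQ_unique by fastforce

  have grad_lim: "- ls \<in> clarke_gradient ?\<Omega> ys"
    by (rule clarke_gradient_closed_graph[OF y_lim tendsto_minus[OF l_lim] grad])

  have "xs \<in> X"
    using closed_sequentially[OF compact_imp_closed[OF \<open>compact X\<close>] _ x_lim] xX by blast
  moreover have "(transpose R *v ls) \<bullet> (z - xs) \<le> 0" if "z \<in> X" for z
  proof -
    have "(\<lambda>k. y (Suc (j k)) - y (j k)) \<longlonglongrightarrow> 0"
      using LIMSEQ_subseq_LIMSEQ[OF dy0 j_mono] by (simp add: o_def)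
    then have "(\<lambda>k. (l (Suc (j k)) - \<sigma> *\<^sub>R (y (Suc (j k)) - y (j k)))
          \<bullet> (R *v (z - x (Suc (j k))))) \<longlonglongrightarrow> (ls - \<sigma> *\<^sub>R 0) \<bullet> (R *v (z - xs))"
      by (intro tendsto_intros l_lim R_lim x_lim)
    then have "(ls - \<sigma> *\<^sub>R 0) \<bullet> (R *v (z - xs)) \<le> 0"
      by (rule LIMSEQ_le_const2) (use normal[OF that] in auto)
    then show ?thesis
      by (simp add: dot_lmul_matrix flip: vector_transpose_matrix)
  qed
  ultimately have normal_lim: "transpose R *v ls \<in> normal_cone X xs"
    by (simp add: normal_cone_def)

  have "transpose R *v (- ls) + transpose R *v ls = 0"
    using matrix_vector_right_distrib[of "transpose R" "- ls" ls] by simp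
  then have "0 \<in> (\<lambda>g. transpose R *v g) ` clarke_gradient ?\<Omega> ys + normal_cone X xs"
    using grad_lim normal_lim by (metis image_eqI set_plus_intro)
  with feasible show ?thesis by simp
qed

end
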